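(* Consider one iteration of the 2-level MGProx method (steps (i)--(iv) in the context), with $P=c\,R(y_0^{k+1})^\top$. If $P(x_1^{k+1}-y_1^{k+1})\neq 0$, then $$\big\langle q,\;P(x_1^{k+1}-y_1^{k+1})\big\rangle<0\qquad\text{for every subgradient } q\in\partial F_0(y_0^{k+1}).$$
   Context: Problem: minimize $F_0(x)=f_0(x)+g_0(x)$ over $x\in\mathbb{R}^{n_0}$. Here $f_0:\mathbb{R}^{n_0}\to\mathbb{R}$ is $L_0$-smooth (differentiable with $L_0$-Lipschitz gradient) and $\mu_0$-strongly convex, $\mu_0>0$ (i.e. $f_0-\frac{\mu_0}{2}\|\cdot\|_2^2$ is convex); $g_0:\mathbb{R}^{n_0}\to\mathbb{R}$ is proper, convex, possibly nonsmooth and separable, $g_0(x)=\sum_i g_{0,i}(x_i)$, with a single point of nondifferentiability (each $g_{0,i}$ is nondifferentiable at at most one point). $\partial$ denotes the convex subdifferential. Coarse functions: let $n_1\le n_0$ and let $Q\in\mathbb{R}^{n_0\times n_1}$ have rank $n_1$. Put $f_1=f_0\circ Q$, $g_1=g_0\circ Q$, $F_1=f_1+g_1=F_0\circ Q:\mathbb{R}^{n_1}\to\mathbb{R}$. Adaptive restriction and prolongation: given a full restriction matrix $\overline{R}\in\mathbb{R}^{n_1\times n_0}$, for $y\in\mathbb{R}^{n_0}$ the adaptive restriction matrix $R(y)$ is obtained from $\overline{R}$ by setting to zero every column $i$ for which $\partial g_{0,i}(y_i)$ is not a singleton. Thus $R(y)\,\partial F_0(y)$ is a singleton. The associated prolongation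 is $P=c\,R(y)^\top$ with a fixed constant $c>0$. Proximal operator: $\mathrm{prox}_{\beta g}(x)=\mathrm{argmin}_u\{\beta g(u)+\frac12\|u-x\|_2^2\}$. MGProx steps: given $x_0^k$, (i) $y_0^{k+1}=\mathrm{prox}_{\frac1{L_0}g_0}\big(x_0^k-\frac1{L_0}\nabla f_0(x_0^k)\big)$; (ii) $y_1^{k+1}=R(y_0^{k+1})\,y_0^{k+1}$; (iii) choose any $\tau_{0\to1}^{k+1}\in \partial F_1(y_1^{k+1})-R(y_0^{k+1})\,\partial F_0(y_0^{k+1})$; (iv) $x_1^{k+1}=\mathrm{argmin}_{\xi\in\mathbb{R}^{n_1}}\{F_1(\xi)-\langle\tau_{0\to1}^{k+1},\xi\rangle\}$. *)

theory Defs
  imports "HOL-Analysis.Analysis"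
begin

definition subdifferential :: "('a::real_inner \<Rightarrow> real) \<Rightarrow> 'a \<Rightarrow> 'a set" where
  "subdifferential f x = {q. \<forall>z. f z \<ge> f x + q \<bullet> (z - x)}"

text \<open>Only meaningful where \<open>f\<close> is differentiable; the gradient is then unique.\<close>

definition gradient :: "('a::real_inner \<Rightarrow> real) \<Rightarrow> 'a \<Rightarrow> 'a" where
  "gradient f x = (THE d. GDERIV f x :> d)"

definition smooth_fun :: "real \<Rightarrow> ('a::real_inner \<Rightarrow> real) \<Rightarrow> bool" where
  "smooth_fun L f \<longleftrightarrow> (\<forall>x. f differentiable (at x)) \<and> lipschitz_on L UNIV (gradient f)"

definition strongly_convex :: "real \<Rightarrow> ('a::real_inner \<Rightarrow> real) \<Rightarrow> bool" where
  "strongly_convex \<mu> f \<longleftrightarrow> convex_on UNIV (\<lambda>x. f x - \<mu> / 2 * (norm x)\<^sup>2)"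

text \<open>For \<open>\<beta> > 0\<close> and convex \<open>g\<close> on a Euclidean space the minimiser exists and is unique.\<close>

definition prox :: "real \<Rightarrow> ('a::real_inner \<Rightarrow> real) \<Rightarrow> 'a \<Rightarrow> 'a" where
  "prox \<beta> g x = arg_min (\<lambda>u. \<beta> * g u + 1 / 2 * (norm (u - x))\<^sup>2) (\<lambda>u. True)"

text \<open>Here \<open>g i\<close> is the \<open>i\<close>-th component function of the separable nonsmooth term.\<close>

definition adaptive_restriction ::
    "('n \<Rightarrow> real \<Rightarrow> real) \<Rightarrow> real^'n^'m \<Rightarrow> real^'n \<Rightarrow> real^'n^'m" where
  "adaptive_restriction g Rbar y =
     (\<chi> j i. if is_singleton (subdifferential (g i) (y $ i)) then Rbar $ j $ i else 0)"

end

theory Submission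
  imports Defs
begin

text \<open>
  Let \<open>d = x1 - y1\<close> and \<open>\<tau> = s - R q'\<close>. The rows of \<open>R\<close> only see coordinates in which \<open>g0\<close>
  has a single subgradient, and \<open>f0\<close> is differentiable, so \<open>R q = R q'\<close> for every
  \<open>q \<in> \<partial>F0(y0)\<close>; hence \<open>\<langle>q, P d\<rangle> = c \<langle>s - \<tau>, d\<rangle>\<close>. As \<open>Q\<close> is injective, \<open>F1\<close> is strictly convex,
  so \<open>\<langle>s, d\<rangle> < F1(x1) - F1(y1)\<close>, while minimality of \<open>x1\<close> gives \<open>F1(x1) - F1(y1) \<le> \<langle>\<tau>, d\<rangle>\<close>.
\<close>

text \<open>So \<open>q - f'\<close> acts as a subgradient of \<open>g\<close>. On the segment from
  \<open>x\<close> to \<open>z\<close>, the inequality for \<open>q\<close> bounds the increment of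
  \<open>f\<close> below, and convexity bounds that of \<open>g\<close> above by
  \<open>t * (g z - g x)\<close>; dividing by \<open>t\<close> and letting \<open>t\<close> tend to
  0 from the right leaves only the derivative of \<open>f\<close>.\<close>

lemma subdifferential_add_has_derivative:
  fixes f g :: "'a::real_inner \<Rightarrow> real"
  assumes f: "(f has_derivative f') (at x)"
    and g: "convex_on UNIV g"
    and q: "q \<in> subdifferential (\<lambda>x. f x + g x) x"
  shows "g x + (q \<bullet> (z - x) - f' (z - x)) \<le> g z"
proof -
  define d where "d = z - x"
  interpret f': bounded_linear f'
    using f by (rule has_derivative_bounded_linear)
  \<comment> \<open>The base point is written as the value at \<open>t = 0\<close> of the line
    through \<open>x\<close> with direction \<open>d\<close>, the form the chain rule
    expects.\<close>
  have "(f has_derivative f') (at (x + 0 *\<^sub>R d))"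
    using f by simp
  then have "((\<lambda>t. f (x + t *\<^sub>R d)) has_derivative (\<lambda>t. f' (t *\<^sub>R d))) (at 0)"
    by (rule has_derivative_compose[rotated]) (auto intro!: derivative_eq_intros)
  then have "((\<lambda>t. f (x + t *\<^sub>R d)) has_real_derivative f' d) (at 0)"
    by (simp add: has_field_derivative_def f'.scaleR mult_commute_abs)
  then have lim: "((\<lambda>t. (f (x + t *\<^sub>R d) - f x) / t) \<longlongrightarrow> f' d) (at_right 0)"
    by (auto simp: has_field_derivative_iff intro: tendsto_within_subset)
  have "q \<bullet> d - (g z - g x) \<le> (f (x + t *\<^sub>R d) - f x) / t" if t: "0 < t" "t < 1" for t
  proof -
    have "f x + g x + t * (q \<bullet> d) \<le> f (x + t *\<^sub>R d) + g (x + t *\<^sub>R d)"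
      using q unfolding subdifferential_def
      by (auto dest: spec[of _ "x + t *\<^sub>R d"])
    moreover have "g (x + t *\<^sub>R d) \<le> (1 - t) * g x + t * g z"
      using convex_onD[OF g, of t x z] t by (simp add: d_def algebra_simps)
    ultimately show ?thesis
      using t by (simp add: field_simps)
  qed
  \<comment> \<open>The witness 1 is the length of the interval of \<open>t\<close> for which
    \<open>x + t *\<^sub>R d\<close> is a convex combination of \<open>x\<close> and
    \<open>z\<close>.\<close>
  then have "\<forall>\<^sub>F t in at_right 0. q \<bullet> d - (g z - g x) \<le> (f (x + t *\<^sub>R d) - f x) / t"
    by (auto simp: eventually_at_right_field intro!: exI[of _ 1])
  then have "q \<bullet> d - (g z - g x) \<le> f' d"
    by (rule tendsto_lowerbound[OF lim]) simp
  then show ?thesis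
    by (simp add: d_def)
qed

text \<open>Test the previous inequality only at points differing from \<open>y\<close> in
  coordinate \<open>i\<close>: all other summands of \<open>g0\<close> cancel, leaving a
  one-variable subgradient inequality.\<close>

lemma subdifferential_separable_component:
  fixes f g0 :: "real^'n \<Rightarrow> real" and g :: "'n \<Rightarrow> real \<Rightarrow> real"
  assumes f: "(f has_derivative f') (at y)"
    and g0: "convex_on UNIV g0"
    and sep: "\<And>x. g0 x = (\<Sum>i\<in>UNIV. g i (x $ i))"
    and q: "q \<in> subdifferential (\<lambda>x. f x + g0 x) y"
  shows "q $ i - f' (axis i 1) \<in> subdifferential (g i) (y $ i)"
  unfolding subdifferential_def
proof (intro CollectI allI)
  fix t
  define z where "z = y + (t - y $ i) *\<^sub>R axis i 1"
  interpret f': bounded_linear f'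
    using f by (rule has_derivative_bounded_linear)
  have "g0 z - g0 y = (\<Sum>j\<in>UNIV. g j (z $ j) - g j (y $ j))"
    by (simp add: sep sum_subtractf)
  also have "\<dots> = (\<Sum>j\<in>UNIV. if j = i then g i t - g i (y $ i) else 0)"
    by (intro sum.cong) (auto simp: z_def axis_def)
  finally have g0_diff: "g0 z - g0 y = g i t - g i (y $ i)"
    by simp
  have z_diff: "z - y = (t - y $ i) *\<^sub>R axis i 1"
    by (simp add: z_def)
  have "g0 y + (t - y $ i) * (q $ i - f' (axis i 1)) \<le> g0 z"
    using subdifferential_add_has_derivative[OF f g0 q, of z]
    by (simp add: z_diff f'.scaleR inner_axis right_diff_distrib)
  then show "g i (y $ i) + (q $ i - f' (axis i 1)) \<bullet> (t - y $ i) \<le> g i t"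
    using g0_diff by (simp add: mult.commute)
qed

text \<open>In a retained column the singleton forces the shifted components of \<open>q\<close> and
  \<open>r\<close> to agree, and both carry the same shift \<open>f' (axis i 1)\<close>; elsewhere
  the column is zero.\<close>

lemma adaptive_restriction_subdifferential_unique:
  fixes f g0 :: "real^'n \<Rightarrow> real"
  assumes f: "f differentiable (at y)"
    and g0: "convex_on UNIV g0"
    and sep: "\<And>x. g0 x = (\<Sum>i\<in>UNIV. g i (x $ i))"
    and q: "q \<in> subdifferential (\<lambda>x. f x + g0 x) y"
    and r: "r \<in> subdifferential (\<lambda>x. f x + g0 x) y"
  shows "adaptive_restriction g Rbar y *v q = adaptive_restriction g Rbar y *v r"
proof -
  obtain f' where f': "(f has_derivative f') (at y)"
    using f by (auto simp: differentiable_def)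
  have "q $ i = r $ i" if "is_singleton (subdifferential (g i) (y $ i))" for i
    using that subdifferential_separable_component[OF f' g0 sep q, of i]
      subdifferential_separable_component[OF f' g0 sep r, of i]
    by (auto simp: is_singleton_def)
  then show ?thesis
    by (auto simp: vec_eq_iff matrix_vector_mult_def adaptive_restriction_def intro!: sum.cong)
qed

lemma strongly_convex_midpoint_less:
  fixes f :: "'a::real_inner \<Rightarrow> real"
  assumes "strongly_convex \<mu> f" "\<mu> > 0" "x \<noteq> y"
  shows "f ((1 / 2) *\<^sub>R (x + y)) < (f x + f y) / 2"
proof -
  let ?m = "(1 / 2) *\<^sub>R (x + y)"
  have midpoint: "f ?m - \<mu> / 2 * (norm ?m)\<^sup>2
      \<le> ((f x - \<mu> / 2 * (norm x)\<^sup>2) + (f y - \<mu> / 2 * (norm y)\<^sup>2)) / 2"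
    using convex_onD[of UNIV "\<lambda>x. f x - \<mu> / 2 * (norm x)\<^sup>2" "1 / 2" x y] assms(1)
    by (simp add: strongly_convex_def scaleR_add_right field_simps)
  \<comment> \<open>The parallelogram law; its last term times \<open>\<mu> / 2\<close> is the gap
    with factor \<open>\<mu> / 8\<close> below.\<close>
  have norm_midpoint: "(norm ?m)\<^sup>2 = ((norm x)\<^sup>2 + (norm y)\<^sup>2) / 2 - (norm (x - y))\<^sup>2 / 4"
    by (simp add: power2_norm_eq_inner inner_add inner_diff inner_commute field_simps)
  have "f ?m \<le> (f x + f y) / 2 - \<mu> / 8 * (norm (x - y))\<^sup>2"
    using midpoint unfolding norm_midpoint by (simp add: field_simps)
  moreover have "\<mu> / 8 * (norm (x - y))\<^sup>2 > 0"
    using assms by simp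
  ultimately show ?thesis
    by linarith
qed

text \<open>The subgradient inequality taken at the midpoint sees half of \<open>x - y\<close>;
  doubling it carries the strictness over to the endpoint \<open>x\<close>.\<close>

lemma subdifferential_midpoint_less:
  assumes s: "s \<in> subdifferential F y"
    and mid: "F ((1 / 2) *\<^sub>R (x + y)) < (F x + F y) / 2"
  shows "s \<bullet> (x - y) < F x - F y"
proof -
  have "(1 / 2) *\<^sub>R (x + y) - y = (1 / 2) *\<^sub>R (x - y)"
    by (simp add: algebra_simps flip: scaleR_2)
  then have "F y + (s \<bullet> (x - y)) / 2 \<le> F ((1 / 2) *\<^sub>R (x + y))"
    using s unfolding subdifferential_def
    by (auto dest: spec[of _ "(1 / 2) *\<^sub>R (x + y)"])
  with mid show ?thesis
    by (simp add: field_simps)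
qed

theorem theorem2p5:
  fixes f0 g0 F0 :: "real^'n \<Rightarrow> real"
    and g :: "'n \<Rightarrow> real \<Rightarrow> real"
    and f1 g1 F1 :: "real^'m \<Rightarrow> real"
    and L0 \<mu>0 c :: real
    and Q :: "real^'m^'n"
    and Rbar R :: "real^'n^'m"
    and P :: "real^'m^'n"
    and x0 y0 :: "real^'n"
    and y1 x1 \<tau> :: "real^'m"
  assumes f0_smooth: "smooth_fun L0 f0"
    and mu_pos: "\<mu>0 > 0"
    and f0_strong: "strongly_convex \<mu>0 f0"
    and g0_convex: "convex_on UNIV g0"
    and g0_separable: "\<And>x. g0 x = (\<Sum>i\<in>UNIV. g i (x $ i))"
    and g_nondiff: "\<And>i s t. \<not> g i differentiable (at s) \<Longrightarrow> \<not> g i differentiable (at t) \<Longrightarrow> s = t"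
    and F0_eq: "F0 = (\<lambda>x. f0 x + g0 x)"
    and dims: "CARD('m) \<le> CARD('n)"
    and Q_rank: "rank Q = CARD('m)"
    and f1_eq: "f1 = (\<lambda>\<xi>. f0 (Q *v \<xi>))"
    and g1_eq: "g1 = (\<lambda>\<xi>. g0 (Q *v \<xi>))"
    and F1_eq: "F1 = (\<lambda>\<xi>. f1 \<xi> + g1 \<xi>)"
    and c_pos: "c > 0"
    and step_i: "y0 = prox (1 / L0) g0 (x0 - (1 / L0) *\<^sub>R gradient f0 x0)"
    and R_eq: "R = adaptive_restriction g Rbar y0"
    and P_eq: "P = c *\<^sub>R transpose R"
    and step_ii: "y1 = R *v y0"
    and step_iii: "\<tau> \<in> {s - R *v q | s q. s \<in> subdifferential F1 y1 \<and> q \<in> subdifferential F0 y0}"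
    and step_iv: "is_arg_min (\<lambda>\<xi>. F1 \<xi> - \<tau> \<bullet> \<xi>) (\<lambda>\<xi>. True) x1"
    and nonzero: "P *v (x1 - y1) \<noteq> 0"
  shows "\<forall>q \<in> subdifferential F0 y0. q \<bullet> (P *v (x1 - y1)) < 0"
proof
  fix q assume q: "q \<in> subdifferential F0 y0"
  define d where "d = x1 - y1"
  obtain s q' where tau: "\<tau> = s - R *v q'"
    and s: "s \<in> subdifferential F1 y1" and q': "q' \<in> subdifferential F0 y0"
    using step_iii by blast
  have "R *v q = R *v q'"
    unfolding R_eq
    using adaptive_restriction_subdifferential_unique[OF _ g0_convex g0_separable]
      f0_smooth q q' unfolding F0_eq smooth_fun_def by blast
  moreover have "q \<bullet> (transpose R *v d) = (R *v q) \<bullet> d"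
    by (metis dot_lmul_matrix inner_commute transpose_matrix_vector)
  \<comment> \<open>By the choice of \<open>\<tau>\<close>, \<open>s - \<tau>\<close> is
    \<open>R *v q'\<close>, which equals \<open>R *v q\<close>.\<close>
  ultimately have inner_eq: "q \<bullet> (P *v d) = c * ((s - \<tau>) \<bullet> d)"
    by (simp add: P_eq tau flip: scaleR_matrix_vector_assoc)
  \<comment> \<open>Full column rank keeps \<open>x1\<close> and \<open>y1\<close> apart under
    \<open>Q\<close>, so strong convexity of \<open>f0\<close> yields a strict midpoint inequality
    for \<open>f1\<close>.\<close>
  have "inj ((*v) Q)"
    using Q_rank by (simp add: full_rank_injective)
  moreover have "x1 \<noteq> y1"
    using nonzero by auto
  ultimately have neq: "Q *v x1 \<noteq> Q *v y1"
    by (auto dest: injD)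
  have Q_mid: "Q *v ((1 / 2) *\<^sub>R (x1 + y1)) = (1 / 2) *\<^sub>R (Q *v x1 + Q *v y1)"
    by (simp add: matrix_vector_mult_scaleR matrix_vector_right_distrib)
  have "f1 ((1 / 2) *\<^sub>R (x1 + y1)) < (f1 x1 + f1 y1) / 2"
    unfolding f1_eq Q_mid by (rule strongly_convex_midpoint_less[OF f0_strong mu_pos neq])
  moreover have "g1 ((1 / 2) *\<^sub>R (x1 + y1)) \<le> (g1 x1 + g1 y1) / 2"
    unfolding g1_eq Q_mid
    using convex_onD[OF g0_convex, of "1 / 2" "Q *v x1" "Q *v y1"]
    by (simp add: scaleR_add_right)
  ultimately have "F1 ((1 / 2) *\<^sub>R (x1 + y1)) < (F1 x1 + F1 y1) / 2"
    by (simp add: F1_eq)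
  then have "s \<bullet> d < F1 x1 - F1 y1"
    unfolding d_def by (rule subdifferential_midpoint_less[OF s])
  \<comment> \<open>The minimiser \<open>x1\<close> of the tilted coarse objective is compared with
    \<open>y1\<close>.\<close>
  also have "F1 x1 - F1 y1 \<le> \<tau> \<bullet> d"
    using step_iv by (auto simp: is_arg_min_linorder d_def inner_diff_right dest: spec[of _ y1])
  finally have "(s - \<tau>) \<bullet> d < 0"
    by (simp add: inner_diff_left)
  then show "q \<bullet> (P *v (x1 - y1)) < 0"
    using c_pos inner_eq by (simp add: d_def mult_pos_neg)
qed

end
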